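(* Let $\mathbb{F}$ be a field of characteristic not two, let $V$ be an $n$-dimensional vector space over $\mathbb{F}$, and let $X:V^r\to V$ be an $r$-fold cross product on $V$ relative to the nondegenerate symmetric bilinear form $b$ and also relative to the nondegenerate symmetric bilinear form $b'$. (1) If $n\geq 3$ and $r=n-1$, then there is a scalar $\mu\in\mathbb{F}$ with $\mu^{n-2}=1$ such that $b'=\mu b$. In particular, for $n=3$, $b$ is uniquely determined by $X$. (2) If $n=8$ and $r=3$, then $b'$ equals either $b$ or $-b$. In particular, the bilinear form $b$ is unique if $(V,X,b)$ is assumed to be of type I.
   Context: Given a finite-dimensional vector space $V$ over $\mathbb{F}$ and a nondegenerate symmetric bilinear form $b:V\times V\to\mathbb{F}$, an $r$-fold cross product on $V$ relative to $b$ ($1\le r\le n=\dim V$) is a multilinear map $X:V^r\to V$ such that, for all $v_1,\dots,v_r\in V$, $b(X(v_1,\dots,v_r),v_i)=0$ for $1\le i\le r$, and $b(X(v_1,\dots,v_r),X(v_1,\dots,v_r))=\det\big(b(v_i,v_j)\big)$. For $n=8$, $r=3$, the triple $(V,X,b)$ is said to be of type I (if $\epsilon=1$), or of type II (if $\epsilon=-1$), if for all $u_1,u_2,u_3,v_1,v_2,v_3\in V$ $$b\big(X(u_1,u_2,u_3),X(v_1,v_2,v_3)\big)=\det\big(b(u_i,v_j)\big)+\epsilon\sum_{\sigma\ \mathrm{even}}\sum_{\tau\ \mathrm{even}} b(u_{\sigma(1)},v_{\tau(1)})\,b\big(u_{\sigma(2)},X(u_{\sigma(3)},v_{\tau(2)},v_{\tau(3)})\big),$$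 the sums being over the even permutations of $\{1,2,3\}$. (Each such triple is of type I or of type II, and if $(V,X,b)$ is of type I then $(V,X,-b)$ is of type II.) *)

theory Defs
  imports "Jordan_Normal_Form.Determinant"
begin

text \<open>
  The vector space V is the whole type \<open>'v\<close>, with scalar multiplication \<open>scale\<close>.
  An element of the r-fold power of V is a list of length r; the values of \<open>X\<close>
  on lists of any other length are irrelevant.
\<close>

definition nondegenerate_symmetric_bilinear_form ::
    "('f::field \<Rightarrow> 'v::ab_group_add \<Rightarrow> 'v) \<Rightarrow> ('v \<Rightarrow> 'v \<Rightarrow> 'f) \<Rightarrow> bool" where
  "nondegenerate_symmetric_bilinear_form scale b \<longleftrightarrow>
     (\<forall>x. Vector_Spaces.linear scale (*) (\<lambda>y. b x y)) \<and>
     (\<forall>y. Vector_Spaces.linear scale (*) (\<lambda>x. b x y)) \<and>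
     (\<forall>x y. b x y = b y x) \<and>
     (\<forall>x. (\<forall>y. b x y = 0) \<longrightarrow> x = 0)"

definition multilinear_map ::
    "('f::field \<Rightarrow> 'v::ab_group_add \<Rightarrow> 'v) \<Rightarrow> nat \<Rightarrow> ('v list \<Rightarrow> 'v) \<Rightarrow> bool" where
  "multilinear_map scale r X \<longleftrightarrow>
     (\<forall>vs. length vs = r \<longrightarrow>
        (\<forall>i<r. Vector_Spaces.linear scale scale (\<lambda>x. X (vs[i := x]))))"

definition gram_matrix :: "('v \<Rightarrow> 'v \<Rightarrow> 'f) \<Rightarrow> 'v list \<Rightarrow> 'v list \<Rightarrow> 'f mat" where
  "gram_matrix b us vs = mat (length us) (length vs) (\<lambda>(i, j). b (us ! i) (vs ! j))"

definition cross_product ::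
    "('f::field \<Rightarrow> 'v::ab_group_add \<Rightarrow> 'v) \<Rightarrow> nat \<Rightarrow> ('v list \<Rightarrow> 'v) \<Rightarrow> ('v \<Rightarrow> 'v \<Rightarrow> 'f) \<Rightarrow> bool" where
  "cross_product scale r X b \<longleftrightarrow>
     1 \<le> r \<and> r \<le> vector_space.dim scale (UNIV :: 'v set) \<and>
     nondegenerate_symmetric_bilinear_form scale b \<and>
     multilinear_map scale r X \<and>
     (\<forall>vs. length vs = r \<longrightarrow>
        (\<forall>i<r. b (X vs) (vs ! i) = 0) \<and>
        b (X vs) (X vs) = det (gram_matrix b vs vs))"

text \<open>Types I and II of threefold cross products in dimension 8; the indices 1, 2, 3
  of the usual formula become the list positions 0, 1, 2.\<close>

definition even_perms3 :: "(nat \<Rightarrow> nat) set" where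
  "even_perms3 = {\<sigma>. \<sigma> permutes {0, 1, 2} \<and> evenperm \<sigma>}"

definition of_type ::
    "'f \<Rightarrow> ('f::field \<Rightarrow> 'v::ab_group_add \<Rightarrow> 'v) \<Rightarrow> ('v list \<Rightarrow> 'v) \<Rightarrow> ('v \<Rightarrow> 'v \<Rightarrow> 'f) \<Rightarrow> bool" where
  "of_type \<epsilon> scale X b \<longleftrightarrow>
     vector_space.dim scale (UNIV :: 'v set) = 8 \<and>
     cross_product scale 3 X b \<and>
     (\<forall>us vs. length us = 3 \<longrightarrow> length vs = 3 \<longrightarrow>
        b (X us) (X vs) =
          det (gram_matrix b us vs) +
          \<epsilon> * (\<Sum>\<sigma>\<in>even_perms3. \<Sum>\<tau>\<in>even_perms3.
                 b (us ! \<sigma> 0) (vs ! \<tau> 0) *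
                 b (us ! \<sigma> 1) (X [us ! \<sigma> 2, vs ! \<tau> 1, vs ! \<tau> 2])))"

definition type_I ::
    "('f::field \<Rightarrow> 'v::ab_group_add \<Rightarrow> 'v) \<Rightarrow> ('v list \<Rightarrow> 'v) \<Rightarrow> ('v \<Rightarrow> 'v \<Rightarrow> 'f) \<Rightarrow> bool" where
  "type_I = of_type 1"

definition type_II ::
    "('f::field \<Rightarrow> 'v::ab_group_add \<Rightarrow> 'v) \<Rightarrow> ('v list \<Rightarrow> 'v) \<Rightarrow> ('v \<Rightarrow> 'v \<Rightarrow> 'f) \<Rightarrow> bool" where
  "type_II = of_type (- 1)"

end

theory Submission
  imports Defs
begin

text \<open>
  Work in a \<open>b\<close>-orthogonal basis and show that it is also \<open>b'\<close>-orthogonal, with constant ratio of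
  the norms. For \<open>r = n - 1\<close>, the product of all basis vectors but one is a multiple of the missing
  one, and the alternation of \<open>b (X vs) v\<close> and \<open>b' (X vs) v\<close> relates the norms; comparing the
  norms of one product then gives \<open>\<mu> ^ (n - 1) = \<mu>\<close>. For \<open>r = 3\<close>, the square of \<open>X [u, v, _]\<close> acts
  modulo \<open>u\<close> and \<open>v\<close> as minus the Gram determinant of \<open>u\<close> and \<open>v\<close>, so \<open>X\<close> determines all these
  determinants, and these determine \<open>b\<close> up to sign.
\<close>

section \<open>Orthogonal bases of a nondegenerate symmetric form\<close>

locale form_space = finite_dimensional_vector_space scale Basis
  for scale :: "'f::field \<Rightarrow> 'v::ab_group_add \<Rightarrow> 'v" (infixr \<open>*s\<close> 75)
    and Basis :: "'v set" +
  fixes b :: "'v \<Rightarrow> 'v \<Rightarrow> 'f"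
  assumes form: "nondegenerate_symmetric_bilinear_form scale b"
    and char_neq_2: "CHAR('f) \<noteq> 2"
begin

lemma two_neq_0: "(2::'f) \<noteq> 0"
proof
  assume "(2::'f) = 0"
  then have "CHAR('f) dvd 2"
    by (metis of_nat_eq_0_iff_char_dvd of_nat_numeral)
  then have "CHAR('f) = 1 \<or> CHAR('f) = 2"
    using two_is_prime_nat prime_nat_iff by blast
  then show False
    using char_neq_2 by simp
qed

lemma linear_left: "Vector_Spaces.linear scale (*) (\<lambda>x. b x y)"
  and linear_right: "Vector_Spaces.linear scale (*) (\<lambda>y. b x y)"
  and form_sym: "b x y = b y x"
  using form by (auto simp: nondegenerate_symmetric_bilinear_form_def)

lemma hom_left: "module_hom scale (*) (\<lambda>x. b x y)"
  and hom_right: "module_hom scale (*) (\<lambda>y. b x y)"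
  using linear_left linear_right by (simp_all add: Vector_Spaces.linear.axioms(3))

lemmas bilinear [simp] =
  module_hom.add[OF hom_left] module_hom.add[OF hom_right]
  module_hom.diff[OF hom_left] module_hom.diff[OF hom_right]
  module_hom.scale[OF hom_left] module_hom.scale[OF hom_right]
  module_hom.neg[OF hom_left] module_hom.neg[OF hom_right]
  module_hom.zero[OF hom_left] module_hom.zero[OF hom_right]
  module_hom.sum[OF hom_left] module_hom.sum[OF hom_right]

lemma nondegenerate:
  assumes "\<And>y. b x y = 0"
  shows "x = 0"
  using form assms by (auto simp: nondegenerate_symmetric_bilinear_form_def)

lemma eqI:
  assumes "\<And>z. b x z = b y z"
  shows "x = y"
  using nondegenerate[of "x - y"] assms by simp

lemma zero_if_orthogonal_to_spanning:
  assumes "span E = UNIV" "\<And>e. e \<in> E \<Longrightarrow> b x e = 0"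
  shows "x = 0"
proof (rule nondegenerate)
  fix y
  have "y \<in> span E"
    using assms by simp
  then show "b x y = 0"
    by (induction rule: span_induct_alt) (auto simp: assms)
qed

text \<open>Isotropic members are excluded so that projections may divide by \<open>b e e\<close>
  and the family is independent; over a general field an orthogonal set of nonzero vectors need not
  be.\<close>

definition orthogonal_family :: "'v set \<Rightarrow> bool" where
  "orthogonal_family E \<longleftrightarrow> finite E \<and> (\<forall>x\<in>E. b x x \<noteq> 0) \<and> pairwise (\<lambda>x y. b x y = 0) E"

lemma orthogonal_familyD:
  assumes "orthogonal_family E"
  shows "finite E" "x \<in> E \<Longrightarrow> b x x \<noteq> 0" "x \<in> E \<Longrightarrow> y \<in> E \<Longrightarrow> x \<noteq> y \<Longrightarrow> b x y = 0"
  using assms by (auto simp: orthogonal_family_def pairwise_def)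

lemma orthogonal_family_sum:
  assumes "orthogonal_family E" "x \<in> E"
  shows "(\<Sum>e\<in>E. c e * b e x) = c x * b x x"
proof -
  have "(\<Sum>e\<in>E. c e * b e x) = (\<Sum>e\<in>E. if e = x then c x * b x x else 0)"
    using orthogonal_familyD[OF assms(1)] assms(2) by (intro sum.cong) auto
  then show ?thesis
    using orthogonal_familyD(1)[OF assms(1)] assms(2) by simp
qed

lemma orthogonal_family_independent:
  assumes "orthogonal_family E"
  shows "independent E"
proof -
  have "c x = 0" if "(\<Sum>e\<in>E. c e *s e) = 0" "x \<in> E" for c x
  proof -
    have "(\<Sum>e\<in>E. c e * b e x) = b (\<Sum>e\<in>E. c e *s e) x"
      by simp
    then have "c x * b x x = 0"
      using orthogonal_family_sum[OF assms that(2)] that(1) by simp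
    then show ?thesis
      using orthogonal_familyD(2)[OF assms that(2)] by simp
  qed
  then show ?thesis
    using dependent_finite[OF orthogonal_familyD(1)[OF assms]] by auto
qed

text \<open>Otherwise \<open>b\<close> would vanish identically on the orthogonal complement of
  \<open>E\<close>. A vector outside the span, minus its projection to the span, would then be a
  nonzero vector of the radical.\<close>

lemma nonisotropic_orthogonal_vector:
  assumes E: "orthogonal_family E" and "span E \<noteq> UNIV"
  shows "\<exists>w. b w w \<noteq> 0 \<and> (\<forall>e\<in>E. b w e = 0)"
proof (rule ccontr)
  assume "\<not> ?thesis"
  then have isotropic: "b w w = 0" if "\<And>e. e \<in> E \<Longrightarrow> b w e = 0" for w
    using that by blast
  \<comment> \<open>Polarization: a symmetric form whose values \<open>b w w\<close> vanish on a
    subspace is zero there, as 2 is invertible.\<close>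
  have orth: "b v w = 0" if "\<And>e. e \<in> E \<Longrightarrow> b v e = 0" "\<And>e. e \<in> E \<Longrightarrow> b w e = 0" for v w
  proof -
    have "b (v + w) (v + w) = 0" "b v v = 0" "b w w = 0"
      by (rule isotropic; simp add: that)+
    then have "2 * b v w = 0"
      by (simp add: form_sym[of w v])
    then show ?thesis
      using two_neq_0 by simp
  qed
  define proj where "proj x = (\<Sum>e\<in>E. (b x e / b e e) *s e)" for x
  have proj_span: "proj x \<in> span E" for x
    unfolding proj_def by (intro span_sum span_scale span_base)
  have proj_orth: "b (x - proj x) e = 0" if "e \<in> E" for x e
  proof -
    have "b (proj x) e = (\<Sum>d\<in>E. b x d / b d d * b d e)"
      unfolding proj_def by simp
    also have "\<dots> = b x e"
      using orthogonal_family_sum[OF E that, of "\<lambda>d. b x d / b d d"]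
        orthogonal_familyD(2)[OF E that] by simp
    finally show ?thesis by simp
  qed
  obtain x where x: "x \<notin> span E"
    using assms(2) by auto
  define z where "z = x - proj x"
  have z: "b z e = 0" if "e \<in> E" for e
    unfolding z_def by (rule proj_orth[OF that])
  \<comment> \<open>Split \<open>y\<close> into \<open>proj y\<close>, in the span of
    \<open>E\<close>, and \<open>y - proj y\<close>, in its complement; \<open>z\<close> is
    orthogonal to both.\<close>
  have "z = 0"
  proof (rule nondegenerate)
    fix y
    have "b z (proj y) = 0"
      unfolding proj_def by (simp add: z)
    moreover have "b z (y - proj y) = 0"
      by (rule orth[OF z proj_orth])
    ultimately show "b z y = 0"
      by simp
  qed
  then show False
    using x proj_span[of x] by (simp add: z_def)
qed

text \<open>Independence bounds the cardinality of orthogonal families, so one of greatest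
  cardinality exists. It spans, since a nonisotropic vector orthogonal to it would enlarge
  it.\<close>

lemma orthogonal_basis_exists:
  obtains E where "orthogonal_family E" "span E = UNIV" "card E = dim (UNIV :: 'v set)"
proof -
  have bound: "card E \<le> dim (UNIV :: 'v set)" if "orthogonal_family E" for E
    by (rule independent_card_le_dim[OF subset_UNIV orthogonal_family_independent[OF that]])
  have "orthogonal_family {}"
    by (simp add: orthogonal_family_def)
  then obtain E where E: "orthogonal_family E"
    and max: "\<And>F. orthogonal_family F \<Longrightarrow> card F \<le> card E"
    using ex_has_greatest_nat[of orthogonal_family "{}" card "Suc (dim (UNIV :: 'v set))"] bound
    by (metis le_imp_less_Suc)
  have span: "span E = UNIV"
  proof (rule ccontr)
    assume "span E \<noteq> UNIV"
    then obtain w where w: "b w w \<noteq> 0" "\<And>e. e \<in> E \<Longrightarrow> b w e = 0"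
      using nonisotropic_orthogonal_vector[OF E] by blast
    then have "w \<notin> E" by blast
    moreover have "orthogonal_family (insert w E)"
      using E w form_sym by (auto simp: orthogonal_family_def pairwise_insert)
    ultimately show False
      using max[of "insert w E"] orthogonal_familyD(1)[OF E] by simp
  qed
  moreover have "card E = dim (UNIV :: 'v set)"
    using basis_card_eq_dim[of E UNIV] orthogonal_family_independent[OF E] span by simp
  ultimately show ?thesis
    using that E by blast
qed

end

lemma (in form_space) proportional_if_on_spanning:
  assumes b': "form_space scale Basis b'"
    and span: "span E = UNIV"
    and E: "\<And>x y. x \<in> E \<Longrightarrow> y \<in> E \<Longrightarrow> b' x y = \<mu> * b x y"
  shows "b' = (\<lambda>x y. \<mu> * b x y)"
proof (intro ext)
  interpret b': form_space scale Basis b' by (rule b')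
  fix x y
  have *: "b' x e = \<mu> * b x e" if "e \<in> E" for x e
  proof -
    have "x \<in> span E" using span by simp
    then show ?thesis
      by (induction rule: span_induct_alt) (auto simp: E that algebra_simps)
  qed
  have "y \<in> span E" using span by simp
  then show "b' x y = \<mu> * b x y"
    by (induction rule: span_induct_alt) (auto simp: * algebra_simps)
qed

section \<open>Gram determinants\<close>

lemma gram_matrix_carrier [simp]: "gram_matrix b us vs \<in> carrier_mat (length us) (length vs)"
  by (simp add: gram_matrix_def)

lemma det_gram_matrix_scaled:
  "det (gram_matrix (\<lambda>x y. \<mu> * b x y) us vs) = \<mu> ^ length vs * det (gram_matrix b us vs)"
proof -
  have "gram_matrix (\<lambda>x y. \<mu> * b x y) us vs = \<mu> \<cdot>\<^sub>m gram_matrix b us vs"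
    by (auto simp: gram_matrix_def)
  then show ?thesis
    by (simp add: gram_matrix_def)
qed

lemma det_gram_matrix_3:
  fixes b :: "'v \<Rightarrow> 'v \<Rightarrow> 'f::field"
  shows "det (gram_matrix b [x, y, z] [u, v, w]) =
    b x u * (b y v * b z w - b y w * b z v)
    - b x v * (b y u * b z w - b y w * b z u)
    + b x w * (b y u * b z v - b y v * b z u)"
proof -
  have det2: "det A = A $$ (0, 0) * A $$ (1, 1) - A $$ (0, 1) * A $$ (1, 0)"
    if "A \<in> carrier_mat 2 2" for A :: "'f mat"
    using that by (subst laplace_expansion_row[OF that, of 0])
      (auto simp: numeral_2_eq_2 cofactor_def mat_delete_def det_single)
  let ?A = "gram_matrix b [x, y, z] [u, v, w]"
  have A: "?A \<in> carrier_mat 3 3"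
    by (simp add: gram_matrix_def numeral_3_eq_3)
  show ?thesis
    by (subst laplace_expansion_row[OF A, of 0])
      (auto simp: numeral_3_eq_3 cofactor_def mat_delete_def det2 gram_matrix_def
        numeral_2_eq_2 algebra_simps)
qed

text \<open>The matrix is diagonal, and its diagonal entries are the nonzero norms of the
  vectors.\<close>

lemma (in form_space) det_gram_matrix_orthogonal_family:
  assumes E: "orthogonal_family E" and "set vs \<subseteq> E" "distinct vs"
  shows "det (gram_matrix b vs vs) \<noteq> 0"
proof -
  let ?A = "gram_matrix b vs vs"
  have "upper_triangular ?A"
    using assms(2,3) orthogonal_familyD(3)[OF E]
    by (auto simp: upper_triangular_def gram_matrix_def nth_eq_iff_index_eq subset_iff)
  then have "det ?A = prod_list (diag_mat ?A)"
    by (rule det_upper_triangular[OF _ gram_matrix_carrier])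
  also have "\<dots> \<noteq> 0"
    using assms(2) orthogonal_familyD(2)[OF E]
    by (auto simp: diag_mat_def gram_matrix_def subset_iff)
  finally show ?thesis .
qed

section \<open>Cross products of arbitrary arity\<close>

locale cross_product_space = form_space scale Basis b
  for scale :: "'f::field \<Rightarrow> 'v::ab_group_add \<Rightarrow> 'v" (infixr \<open>*s\<close> 75)
    and Basis b +
  fixes r :: nat and X :: "'v list \<Rightarrow> 'v"
  assumes cross: "cross_product scale r X b"
begin

lemma cross_orthogonal: "length vs = r \<Longrightarrow> i < r \<Longrightarrow> b (X vs) (vs ! i) = 0"
  and cross_norm: "length vs = r \<Longrightarrow> b (X vs) (X vs) = det (gram_matrix b vs vs)"
  using cross by (auto simp: cross_product_def)

lemma hom_cross:
  assumes "length vs = r" "i < r"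
  shows "module_hom scale scale (\<lambda>x. X (vs[i := x]))"
  using cross assms by (simp add: cross_product_def multilinear_map_def Vector_Spaces.linear.axioms(3))

lemma cross_orthogonal_mem: "length vs = r \<Longrightarrow> v \<in> set vs \<Longrightarrow> b (X vs) v = 0"
  using cross_orthogonal by (auto simp: in_set_conv_nth)

text \<open>As a bilinear form in \<open>x\<close> and \<open>y\<close>, the left side is
  alternating, because a product is orthogonal to its argument at position \<open>i\<close>.
  Expanding at \<open>x + y\<close> makes it skew-symmetric.\<close>

lemma cross_antisym:
  assumes "length vs = r" "i < r"
  shows "b (X (vs[i := x])) y = - b (X (vs[i := y])) x"
proof -
  have diag: "b (X (vs[i := z])) z = 0" for z
    using cross_orthogonal[of "vs[i := z]" i] assms by simp
  show ?thesis
    using diag[of "x + y"]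
    by (simp add: module_hom.add[OF hom_cross[OF assms]] diag eq_neg_iff_add_eq_0 add.commute)
qed

lemma cross_antisym_Cons:
  assumes "Suc (length vs) = r"
  shows "b (X (x # vs)) y = - b (X (y # vs)) x"
  using cross_antisym[of "x # vs" 0 x y] assms by simp

lemma cross_neq_0:
  assumes "orthogonal_family E" "set vs \<subseteq> E" "distinct vs" "length vs = r"
  shows "X vs \<noteq> 0"
  using det_gram_matrix_orthogonal_family[OF assms(1-3)] cross_norm[OF assms(4)] by auto

end

text \<open>Subtracting from \<open>x\<close> its projection to \<open>i\<close> leaves a vector
  orthogonal to the whole basis.\<close>

lemma (in form_space) multiple_if_orthogonal_to_others:
  assumes E: "orthogonal_family E" "span E = UNIV" and i: "i \<in> E"
    and orth: "\<And>e. e \<in> E - {i} \<Longrightarrow> b x e = 0"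
  obtains c where "x = c *s i"
proof
  have "x - (b x i / b i i) *s i = 0"
  proof (rule zero_if_orthogonal_to_spanning[OF E(2)])
    fix e assume "e \<in> E"
    then show "b (x - (b x i / b i i) *s i) e = 0"
      using orthogonal_familyD[OF E(1)] i orth by (cases "e = i") auto
  qed
  then show "x = (b x i / b i i) *s i" by simp
qed

section \<open>Products of n - 1 vectors\<close>

context cross_product_space
begin

text \<open>For distinct members i, j of an orthogonal basis, the product of the other n - 2 and j is a
  nonzero multiple of i, so the orthogonality of the basis can be read off X alone.\<close>

lemma codim_1_other_form:
  assumes b': "cross_product_space scale Basis b' r X"
    and r: "r = dim (UNIV :: 'v set) - 1" and E: "orthogonal_family E" "span E = UNIV"
    and ij: "i \<in> E" "j \<in> E" "i \<noteq> j"
  shows "b' i j = 0" "b' i i * b j j = b' j j * b i i"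
proof -
  interpret b': cross_product_space scale Basis b' r X by (rule b')
  have card: "card E = dim (UNIV :: 'v set)"
    using basis_card_eq_dim[of E UNIV] orthogonal_family_independent[OF E(1)] E(2) by simp
  have "finite E"
    using orthogonal_familyD(1)[OF E(1)] .
  then obtain xs where xs: "set xs = E - {i, j}" "distinct xs"
    using finite_distinct_list by blast
  have "card {i, j} \<le> card E"
    using ij \<open>finite E\<close> by (intro card_mono) auto
  moreover have "card (E - {i, j}) = card E - 2"
    using ij \<open>finite E\<close> by (subst card_Diff_subset) auto
  ultimately have len: "Suc (length xs) = r"
    using distinct_card[OF xs(2)] xs(1) r card ij by auto
  have multiple: "\<exists>c. X (k # xs) = c *s l \<and> c \<noteq> 0"
    if "k \<in> E" "l \<in> E" "{k, l} = {i, j}" "k \<noteq> l" for k l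
  proof -
    have "set (k # xs) = E - {l}"
      using that xs ij by auto
    then have "b (X (k # xs)) e = 0" if "e \<in> E - {l}" for e
      using cross_orthogonal_mem[of "k # xs" e] that len by simp
    then obtain c where "X (k # xs) = c *s l"
      using multiple_if_orthogonal_to_others[OF E \<open>l \<in> E\<close>] by blast
    moreover have "X (k # xs) \<noteq> 0"
      using that xs ij len by (intro cross_neq_0[OF E(1)]) auto
    ultimately show ?thesis by auto
  qed
  obtain c where c: "X (j # xs) = c *s i" "c \<noteq> 0"
    using multiple[of j i] ij by auto
  obtain d where d: "X (i # xs) = d *s j" "d \<noteq> 0"
    using multiple[of i j] ij by auto
  \<comment> \<open>The product \<open>X (j # xs)\<close> is \<open>b'\<close>-orthogonal to its
    argument \<open>j\<close>, and it is a nonzero multiple of \<open>i\<close>.\<close>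
  show "b' i j = 0"
    using b'.cross_orthogonal_mem[of "j # xs" j] len c by simp
  \<comment> \<open>Exchanging \<open>i\<close> and \<open>j\<close> between the first argument and
    the second slot of the form. The scalars \<open>c\<close> and \<open>d\<close> describe values
    of \<open>X\<close> alone, so they serve both forms.\<close>
  have "c * b i i = - d * b j j" "c * b' i i = - d * b' j j"
    using cross_antisym_Cons[of xs j i] b'.cross_antisym_Cons[of xs j i] len c d by simp_all
  then have "(c * b' i i) * (- d * b j j) = (- d * b' j j) * (c * b i i)"
    by simp
  then have "c * d * (b' i i * b j j) = c * d * (b' j j * b i i)"
    by (simp add: ac_simps)
  then show "b' i i * b j j = b' j j * b i i"
    using c d by simp
qed

lemma codim_1_unique_up_to_scalar:
  assumes b': "cross_product_space scale Basis b' r X"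
    and dim: "dim (UNIV :: 'v set) \<ge> 3" "r = dim (UNIV :: 'v set) - 1"
  obtains \<mu> where "\<mu> ^ (dim (UNIV :: 'v set) - 2) = 1" "b' = (\<lambda>x y. \<mu> * b x y)"
proof -
  interpret b': cross_product_space scale Basis b' r X by (rule b')
  obtain E where E: "orthogonal_family E" "span E = UNIV" "card E = dim (UNIV :: 'v set)"
    by (rule orthogonal_basis_exists)
  have "E \<noteq> {}"
    using E(3) dim by auto
  then obtain i where i: "i \<in> E" by blast
  note other = codim_1_other_form[OF b' dim(2) E(1,2)]
  \<comment> \<open>The ratio of the norms at one basis vector is the ratio at every other one, by
    the second part of \<open>other\<close>.\<close>
  define \<mu> where "\<mu> = b' i i / b i i"
  have diag: "b' j j = \<mu> * b j j" if "j \<in> E" for j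
    using other(2)[OF i that] orthogonal_familyD(2)[OF E(1) i]
    by (cases "i = j") (auto simp: \<mu>_def field_simps)
  have eq: "b' = (\<lambda>x y. \<mu> * b x y)"
  proof (rule proportional_if_on_spanning[OF b'.form_space_axioms E(2)])
    fix x y assume "x \<in> E" "y \<in> E"
    then show "b' x y = \<mu> * b x y"
      using diag other(1) orthogonal_familyD(3)[OF E(1)] by (cases "x = y") auto
  qed
  have "\<mu> \<noteq> 0"
  proof
    assume "\<mu> = 0"
    then have "i = 0"
      using b'.nondegenerate[of i] eq by simp
    then show False
      using orthogonal_familyD(2)[OF E(1) i] by simp
  qed
  obtain xs where xs: "set xs = E - {i}" "distinct xs"
    using finite_distinct_list orthogonal_familyD(1)[OF E(1)] by blast
  have len: "length xs = r"
    using distinct_card[OF xs(2)] xs(1) i orthogonal_familyD(1)[OF E(1)] E(3) dim(2)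
    by (simp add: card_Diff_singleton)
  let ?g = "det (gram_matrix b xs xs)"
  have "?g \<noteq> 0"
    using det_gram_matrix_orthogonal_family[OF E(1)] xs by auto
  \<comment> \<open>The \<open>b'\<close>-norm of \<open>X xs\<close> computed twice: from
    \<open>b' = \<mu> b\<close> directly, and as a \<open>b'\<close>-Gram determinant of size
    \<open>r\<close>.\<close>
  moreover have "\<mu> * ?g = \<mu> ^ r * ?g"
    using cross_norm[OF len] b'.cross_norm[OF len] det_gram_matrix_scaled[of \<mu> b xs xs] len
    by (simp add: eq)
  \<comment> \<open>Here \<open>r\<close> is n - 1, the successor of n - 2; one factor \<mu> is
    split off to be cancelled.\<close>
  ultimately have "\<mu> = \<mu> * \<mu> ^ (dim (UNIV :: 'v set) - 2)"
    using dim by (simp flip: power_Suc add: Suc_diff_Suc numeral_2_eq_2)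
  then have "\<mu> ^ (dim (UNIV :: 'v set) - 2) = 1"
    using \<open>\<mu> \<noteq> 0\<close> by (metis mult.right_neutral mult_left_cancel)
  then show ?thesis
    using that eq by blast
qed

end

section \<open>Threefold products: the form up to sign\<close>

locale cross_product_3_space = cross_product_space scale Basis b 3 X
  for scale :: "'f::field \<Rightarrow> 'v::ab_group_add \<Rightarrow> 'v" (infixr \<open>*s\<close> 75)
    and Basis b X
begin

lemma cross_3_antisym: "b (X [u, v, x]) y = - b (X [u, v, y]) x"
  using cross_antisym[of "[u, v, x]" 2 x y] by (simp add: numeral_2_eq_2)

lemma cross_3_add: "X [u, v, x + y] = X [u, v, x] + X [u, v, y]"
  using module_hom.add[OF hom_cross[of "[u, v, x]" 2]] by (simp add: numeral_2_eq_2)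

text \<open>Polarization of the norm identity in the third argument. The first two arguments must be
  shared: for unrelated triples the analogous identity fails in dimension at least 5, by
  \<open>not_isometric\<close>.\<close>

lemma cross_3_inner:
  "b (X [u, v, x]) (X [u, v, y]) = det (gram_matrix b [u, v, x] [u, v, y])"
proof -
  have norm: "b (X [u, v, z]) (X [u, v, z]) = det (gram_matrix b [u, v, z] [u, v, z])" for z
    by (rule cross_norm) simp
  have "2 * b (X [u, v, x]) (X [u, v, y]) = b (X [u, v, x + y]) (X [u, v, x + y])
      - b (X [u, v, x]) (X [u, v, x]) - b (X [u, v, y]) (X [u, v, y])"
    by (simp add: cross_3_add form_sym[of "X [u, v, y]" "X [u, v, x]"])
  also have "\<dots> = 2 * det (gram_matrix b [u, v, x] [u, v, y])"
    unfolding norm det_gram_matrix_3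
    by (simp add: form_sym[of v u] form_sym[of x u] form_sym[of x v] form_sym[of y u]
        form_sym[of y v] form_sym[of y x] algebra_simps)
  finally have "2 * b (X [u, v, x]) (X [u, v, y]) = 2 * det (gram_matrix b [u, v, x] [u, v, y])" .
  then show ?thesis
    using two_neq_0 by simp
qed

text \<open>Pairing with \<open>z\<close>, skew-symmetry moves the outer product to the second slot,
  where \<open>cross_3_inner\<close> gives a determinant. The coefficients are its cofactors along
  the column of \<open>z\<close>.\<close>

lemma cross_3_square:
  "X [u, v, X [u, v, w]] = - ((b u u * b v v - b u v * b u v) *s w
     + (b u v * b w v - b v v * b w u) *s u + (b w u * b u v - b w v * b u u) *s v)"
proof (rule eqI)
  fix z
  have "b (X [u, v, X [u, v, w]]) z = - b (X [u, v, w]) (X [u, v, z])"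
    using cross_3_antisym form_sym by metis
  then show "b (X [u, v, X [u, v, w]]) z = b (- ((b u u * b v v - b u v * b u v) *s w
     + (b u v * b w v - b v v * b w u) *s u + (b w u * b u v - b w v * b u u) *s v)) z"
    by (simp add: cross_3_inner det_gram_matrix_3 form_sym[of v u] algebra_simps)
qed

text \<open>The left side of \<open>cross_3_square\<close> involves no form, so both forms give the
  same right side. For \<open>w\<close> outside the span of \<open>u\<close> and \<open>v\<close>,
  which exists in dimension at least 3, the coefficients of \<open>w\<close> must agree.\<close>

lemma gram_2_unique:
  assumes b': "cross_product_3_space scale Basis b' X"
    and dim: "dim (UNIV :: 'v set) \<ge> 3"
  shows "b u u * b v v - b u v * b u v = b' u u * b' v v - b' u v * b' u v"
proof (rule ccontr)
  assume neq: "\<not> ?thesis"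
  interpret b': cross_product_3_space scale Basis b' X by (rule b')
  have "dim (UNIV :: 'v set) \<le> card {u, v}" if "span {u, v} = UNIV"
    using that by (intro dim_le_card) auto
  then have "span {u, v} \<noteq> UNIV"
    using dim card_insert_le_m1[of 2 "{v}" u] by auto
  then obtain w where w: "w \<notin> span {u, v}" by auto
  let ?D = "(b u u * b v v - b u v * b u v) - (b' u u * b' v v - b' u v * b' u v)"
  obtain p q p' q' where
    "(b u u * b v v - b u v * b u v) *s w + p *s u + q *s v
      = (b' u u * b' v v - b' u v * b' u v) *s w + p' *s u + q' *s v"
    using cross_3_square[of u v w] b'.cross_3_square[of u v w]
    by (metis neg_equal_iff_equal)
  then have "?D *s w = (p' - p) *s u + (q' - q) *s v"
    by (simp add: algebra_simps)
  moreover have "(p' - p) *s u + (q' - q) *s v \<in> span {u, v}"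
    by (intro span_add span_scale span_base) auto
  ultimately have "?D *s w \<in> span {u, v}"
    by simp
  then have "(1 / ?D) *s ?D *s w \<in> span {u, v}"
    by (rule span_scale)
  moreover have "?D \<noteq> 0"
    using neq by simp
  ultimately show False
    using w by simp
qed

text \<open>For fixed \<open>u\<close> the Gram determinant of \<open>u\<close> and \<open>v\<close>
  is a quadratic form in \<open>v\<close>; this compares the associated bilinear forms.\<close>

lemma gram_2_polarized_unique:
  assumes b': "cross_product_3_space scale Basis b' X"
    and dim: "dim (UNIV :: 'v set) \<ge> 3"
  shows "b u u * b v w - b u v * b u w = b' u u * b' v w - b' u v * b' u w"
proof -
  interpret b': cross_product_3_space scale Basis b' X by (rule b')
  note gram = gram_2_unique[OF b' dim]
  have expand: "2 * (B u u * B v w - B u v * B u w) =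
      (B u u * B (v + w) (v + w) - B u (v + w) * B u (v + w))
      - (B u u * B v v - B u v * B u v) - (B u u * B w w - B u w * B u w)"
    if "form_space scale Basis B" for B
  proof -
    interpret B: form_space scale Basis B by (rule that)
    show ?thesis
      by (simp add: B.form_sym[of w v] algebra_simps)
  qed
  have "2 * (b u u * b v w - b u v * b u w) = 2 * (b' u u * b' v w - b' u v * b' u w)"
    unfolding expand[OF form_space_axioms] expand[OF b'.form_space_axioms] gram ..
  then show ?thesis
    by (simp only: mult_left_cancel[OF two_neq_0])
qed

text \<open>The equal minors make a \<open>b\<close>-orthogonal basis \<open>b'\<close>-orthogonal
  and force the norm ratios of any two different members to have product 1. With three members, all
  ratios coincide and square to 1.\<close>

lemma unique_up_to_sign:
  assumes b': "cross_product_3_space scale Basis b' X"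
    and dim: "dim (UNIV :: 'v set) \<ge> 3"
  shows "b' = b \<or> b' = (\<lambda>x y. - b x y)"
proof -
  interpret b': cross_product_3_space scale Basis b' X by (rule b')
  obtain E where E: "orthogonal_family E" "span E = UNIV" "card E = dim (UNIV :: 'v set)"
    by (rule orthogonal_basis_exists)
  note orth = orthogonal_familyD[OF E(1)]
  \<comment> \<open>The case \<open>i = j\<close> is included; it later yields a pair of different
    members.\<close>
  have third: "\<exists>k\<in>E. k \<noteq> i \<and> k \<noteq> j" for i j
  proof (rule ccontr)
    assume "\<not> ?thesis"
    then have "E \<subseteq> {i, j}" by blast
    then have "card E \<le> card {i, j}" by (intro card_mono) auto
    then show False
      using E(3) dim card_insert_le_m1[of 2 "{j}" i] by auto
  qed
  have mixed: "b' i i * b' j k = b' i j * b' i k"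
    if "i \<in> E" "j \<in> E" "k \<in> E" "i \<noteq> j" "i \<noteq> k" "j \<noteq> k" for i j k
    using gram_2_polarized_unique[OF b' dim, of i j k] orth(3) that by simp
  have minor: "b' i i * b' j j - b' i j * b' i j = b i i * b j j"
    if "i \<in> E" "j \<in> E" "i \<noteq> j" for i j
    using gram_2_unique[OF b' dim, of i j] orth(3) that by simp
  have off_diag: "b' i j = 0" if ij: "i \<in> E" "j \<in> E" "i \<noteq> j" for i j
  proof -
    obtain k where k: "k \<in> E" "k \<noteq> i" "k \<noteq> j"
      using third by blast
    have eqs: "b' k k * b' i j = b' i k * b' j k" "b' i i * b' j k = b' i k * b' i j"
      using mixed[of k i j] mixed[of i k j] ij k
      by (simp_all add: b'.form_sym[of k i] b'.form_sym[of k j])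
    \<comment> \<open>Eliminate \<open>b' j k\<close> from the two equations without dividing by
      \<open>b'\<close>-norms, which are not yet known to be nonzero. The factor left is a minor
      equal to \<open>b i i * b k k\<close>.\<close>
    have "(b' i i * b' k k - b' i k * b' i k) * b' i j
        = b' i i * (b' k k * b' i j) - b' i k * (b' i k * b' i j)"
      by (simp add: algebra_simps)
    also have "\<dots> = b' i k * (b' i i * b' j k) - b' i k * (b' i k * b' i j)"
      unfolding eqs(1) by (simp add: ac_simps)
    also have "\<dots> = 0"
      by (simp only: eqs(2) diff_self)
    finally have "b i i * b k k * b' i j = 0"
      using minor[of i k] ij k by simp
    then show ?thesis
      using orth(2) ij k by simp
  qed
  define c where "c i = b' i i / b i i" for i
  have diag: "b' i i = c i * b i i" if "i \<in> E" for i
    using orth(2)[OF that] by (simp add: c_def)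
  have prod: "c i * c j = 1" if "i \<in> E" "j \<in> E" "i \<noteq> j" for i j
    using minor[OF that] off_diag[OF that] orth(2) that by (simp add: c_def field_simps)
  have const: "c i = c j" if ij: "i \<in> E" "j \<in> E" for i j
  proof -
    obtain k where "k \<in> E" "k \<noteq> i" "k \<noteq> j"
      using third by blast
    then have "c i * c k = 1" "c j * c k = 1"
      using prod ij by blast+
    then show ?thesis
      by (metis mult_right_cancel mult_zero_right zero_neq_one)
  qed
  obtain i j where ij: "i \<in> E" "j \<in> E" "j \<noteq> i"
    using third by metis
  have "c i * c i = 1"
    using prod[of i j] const[of i j] ij by auto
  then have "c i = 1 \<or> c i = - 1"
    by (simp add: square_eq_1_iff)
  moreover have "b' = (\<lambda>x y. c i * b x y)"
  proof (rule proportional_if_on_spanning[OF b'.form_space_axioms E(2)])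
    fix x y assume "x \<in> E" "y \<in> E"
    then show "b' x y = c i * b x y"
      using diag[of x] const[of x i] ij off_diag orth(3) by (cases "x = y") auto
  qed
  ultimately show ?thesis
    by auto
qed

section \<open>Type I excludes the opposite sign\<close>

text \<open>Without the sums of the type I identity, X would map decomposable trivectors isometrically
  to V, which is impossible once the exterior cube of V has greater dimension than V.\<close>

lemma not_isometric:
  assumes dim: "dim (UNIV :: 'v set) \<ge> 5"
  shows "\<not> (\<forall>us vs. length us = 3 \<longrightarrow> length vs = 3 \<longrightarrow>
    b (X us) (X vs) = det (gram_matrix b us vs))"
proof
  assume "\<forall>us vs. length us = 3 \<longrightarrow> length vs = 3 \<longrightarrow>
    b (X us) (X vs) = det (gram_matrix b us vs)"
  then have iso: "b (X [x, y, z]) (X [u, v, w]) = det (gram_matrix b [x, y, z] [u, v, w])"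
    for x y z u v w
    by simp
  obtain E where E: "orthogonal_family E" "span E = UNIV" "card E = dim (UNIV :: 'v set)"
    by (rule orthogonal_basis_exists)
  note orth = orthogonal_familyD[OF E(1)]
  obtain F where "F \<subseteq> E" "card F = 5"
    using obtain_subset_with_card_n[of 5 E] dim E(3) by metis
  then obtain xs where xs: "set xs \<subseteq> E" "distinct xs" "length xs = 5"
    by (metis finite_distinct_list orth(1) rev_finite_subset distinct_card)
  then obtain e d f a a' where "xs = [e, d, f, a, a']"
    by (auto simp: numeral_eq_Suc length_Suc_conv)
  with xs have mem: "e \<in> E" "d \<in> E" "f \<in> E" "a \<in> E" "a' \<in> E"
    and dist: "distinct [e, d, f, a, a']"
    by auto
  \<comment> \<open>A nonzero product, to be shown orthogonal to the whole basis.\<close>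
  define y where "y = X [e, d, f]"
  have y_e: "b y e = 0"
    unfolding y_def by (rule cross_orthogonal_mem) auto
  have y_orth: "b y g = 0" if c: "c \<in> E" "c \<noteq> e" "c \<noteq> d" "c \<noteq> f" and g: "g \<in> E" "g \<noteq> c" for c g
  proof -
    \<comment> \<open>In the Gram matrix of \<open>[e, c, z]\<close> against
      \<open>[e, d, f]\<close> the row of \<open>c\<close> is zero.\<close>
    have "b (X [e, c, z]) y = 0" for z
      unfolding y_def using c mem orth(3) by (simp add: iso det_gram_matrix_3)
    then have "b (X [e, c, y]) z = 0" for z
      using cross_3_antisym[of e c y z] by simp
    then have "X [e, c, y] = 0"
      by (rule nondegenerate)
    \<comment> \<open>For \<open>g\<close> other than \<open>e\<close> this matrix is upper
      triangular with diagonal \<open>b e e\<close>, \<open>b c c\<close>, \<open>b g y\<close>, so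
      the last entry must vanish; the case \<open>g = e\<close> is \<open>y_e\<close>.\<close>
    then have "det (gram_matrix b [e, c, g] [e, c, y]) = 0"
      by (simp flip: cross_3_inner)
    then show ?thesis
      using c g mem orth y_e form_sym[of y]
      by (cases "g = e") (auto simp: det_gram_matrix_3)
  qed
  \<comment> \<open>Taking \<open>c = a\<close> covers every \<open>g\<close> except
    \<open>a\<close> itself, for which \<open>c = a'\<close> is taken; hence five basis
    vectors.\<close>
  have "b y g = 0" if "g \<in> E" for g
    using y_orth[OF mem(4) _ _ _ that] y_orth[OF mem(5) _ _ _ mem(4)] dist by (cases "g = a") auto
  then have "y = 0"
    by (rule zero_if_orthogonal_to_spanning[OF E(2)])
  moreover have "y \<noteq> 0"
    unfolding y_def using mem dist by (intro cross_neq_0[OF E(1)]) auto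
  ultimately show False by simp
qed

text \<open>Negating the form negates the left side and the determinant of size 3, but not the
  double sum, which is quadratic in the form. If both identities held, the sum would vanish, against
  \<open>not_isometric\<close>.\<close>

lemma not_type_I_neg:
  assumes "type_I scale X b"
  shows "\<not> type_I scale X (\<lambda>x y. - b x y)"
proof
  assume neg: "type_I scale X (\<lambda>x y. - b x y)"
  define S where "S us vs = (\<Sum>\<sigma>\<in>even_perms3. \<Sum>\<tau>\<in>even_perms3.
    b (us ! \<sigma> 0) (vs ! \<tau> 0) * b (us ! \<sigma> 1) (X [us ! \<sigma> 2, vs ! \<tau> 1, vs ! \<tau> 2]))" for us vs
  have "b (X us) (X vs) = det (gram_matrix b us vs)"
    if len: "length us = 3" "length vs = 3" for us vs
  proof -
    have "b (X us) (X vs) = det (gram_matrix b us vs) + S us vs"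
      using assms len by (simp add: type_I_def of_type_def S_def)
    moreover have "- b (X us) (X vs) = - det (gram_matrix b us vs) + S us vs"
      using neg len det_gram_matrix_scaled[of "- 1" b us vs]
      by (simp add: type_I_def of_type_def S_def)
    ultimately have "2 * S us vs = 0"
      by simp
    then show ?thesis
      using two_neq_0 \<open>b (X us) (X vs) = _ + _\<close> by simp
  qed
  moreover have "dim (UNIV :: 'v set) \<ge> 5"
    using assms by (simp add: type_I_def of_type_def)
  ultimately show False
    using not_isometric by blast
qed

end

theorem proposition2p3:
  fixes scale :: "'f::field \<Rightarrow> 'v::ab_group_add \<Rightarrow> 'v"
    and Basis :: "'v set"
    and X :: "'v list \<Rightarrow> 'v"
    and b b' :: "'v \<Rightarrow> 'v \<Rightarrow> 'f"
    and n r :: nat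
  assumes "CHAR('f) \<noteq> 2"
    and "finite_dimensional_vector_space scale Basis"
    and "vector_space.dim scale (UNIV :: 'v set) = n"
    and "cross_product scale r X b"
    and "cross_product scale r X b'"
  shows "(n \<ge> 3 \<and> r = n - 1 \<longrightarrow>
            (\<exists>\<mu>. \<mu> ^ (n - 2) = 1 \<and> b' = (\<lambda>x y. \<mu> * b x y))) \<and>
         (n = 3 \<and> r = n - 1 \<longrightarrow> b' = b) \<and>
         (n = 8 \<and> r = 3 \<longrightarrow> b' = b \<or> b' = (\<lambda>x y. - b x y)) \<and>
         (n = 8 \<and> r = 3 \<and> type_I scale X b \<and> type_I scale X b' \<longrightarrow> b' = b)"
proof -
  interpret V: finite_dimensional_vector_space scale Basis by (rule assms(2))
  interpret b: cross_product_space scale Basis b r X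
    using assms by unfold_locales (auto simp: cross_product_def)
  have b': "cross_product_space scale Basis b' r X"
    using assms by unfold_locales (auto simp: cross_product_def)
  have dim: "V.dim (UNIV :: 'v set) = n"
    by (rule assms(3))
  have codim_1: "\<exists>\<mu>. \<mu> ^ (n - 2) = 1 \<and> b' = (\<lambda>x y. \<mu> * b x y)" if "n \<ge> 3" "r = n - 1"
    using b.codim_1_unique_up_to_scalar[OF b'] that unfolding dim by metis
  have sign: "b' = b \<or> b' = (\<lambda>x y. - b x y)" if "n = 8" "r = 3"
  proof -
    interpret c: cross_product_3_space scale Basis b X
      using b.cross_product_space_axioms that(2) by (simp add: cross_product_3_space_def)
    show ?thesis
      using c.unique_up_to_sign b' that dim by (simp add: cross_product_3_space_def)
  qed
  have type_I: "b' = b" if "n = 8" "r = 3" "type_I scale X b" "type_I scale X b'"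
  proof -
    interpret c: cross_product_3_space scale Basis b X
      using b.cross_product_space_axioms that(2) by (simp add: cross_product_3_space_def)
    show ?thesis
      using sign[OF that(1,2)] c.not_type_I_neg that(3,4) by auto
  qed
  \<comment> \<open>For n = 3 the exponent n - 2 is 1, so \<mu> = 1.\<close>
  show ?thesis
    using codim_1 sign type_I by auto
qed

end
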